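(* Let $P$ be a simple $d$-polytope and let $2\le k\le d-1$. A $k$-system $\mathcal{S}$ of $\mathcal{G}_P$ is equal to $\mathcal{V}_k(P)$ if and only if $\mathcal{S}$ has maximal cardinality among all $k$-systems of $\mathcal{G}_P$.
   Context: A $d$-polytope $P$ is simple if every vertex of $P$ is contained in exactly $d$ edges. $\mathcal{G}_P=(\mathcal{V}(P),\mathcal{E}(P))$ denotes the abstract vertex-edge graph of $P$. For $W\subseteq\mathcal{V}(P)$, $\mathcal{G}_P(W)$ is the subgraph of $\mathcal{G}_P$ induced by $W$. $\mathcal{V}_k(P)$ is the set of vertex sets of the $k$-faces ($k$-dimensional faces) of $P$. For $2\le k\le d-1$, a $k$-frame of $P$ is a (not necessarily induced) subgraph of $\mathcal{G}_P$ isomorphic to the star $K_{1,k}$. A set $\mathcal{S}$ of non-empty subsets of $\mathcal{V}(P)$ is a $k$-system of $\mathcal{G}_P$ if for every $S\in\mathcal{S}$ the induced subgraph $\mathcal{G}_P(S)$ is $k$-regular, and the node set of every $k$-frame of $P$ is contained in a unique set from $\mathcal{S}$. *)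

theory Defs
  imports "HOL-Analysis.Analysis"
begin

type_synonym 'a ugraph = "'a set \<times> 'a set set"

abbreviation nodes :: "'a ugraph \<Rightarrow> 'a set" where
  "nodes G \<equiv> fst G"

abbreviation edges :: "'a ugraph \<Rightarrow> 'a set set" where
  "edges G \<equiv> snd G"

definition simple_graph :: "'a ugraph \<Rightarrow> bool" where
  "simple_graph G \<longleftrightarrow> (\<forall>e\<in>edges G. e \<subseteq> nodes G \<and> card e = 2)"

definition subgraph_of :: "'a ugraph \<Rightarrow> 'a ugraph \<Rightarrow> bool" where
  "subgraph_of H G \<longleftrightarrow> simple_graph H \<and> nodes H \<subseteq> nodes G \<and> edges H \<subseteq> edges G"

definition induced :: "'a ugraph \<Rightarrow> 'a set \<Rightarrow> 'a ugraph" where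
  "induced G W = (W, {e \<in> edges G. e \<subseteq> W})"

definition degree :: "'a ugraph \<Rightarrow> 'a \<Rightarrow> nat" where
  "degree G v = card {e \<in> edges G. v \<in> e}"

definition regular :: "nat \<Rightarrow> 'a ugraph \<Rightarrow> bool" where
  "regular k G \<longleftrightarrow> (\<forall>v\<in>nodes G. degree G v = k)"

definition isomorphic_graphs :: "'a ugraph \<Rightarrow> 'b ugraph \<Rightarrow> bool" where
  "isomorphic_graphs G H \<longleftrightarrow>
     (\<exists>f. bij_betw f (nodes G) (nodes H) \<and>
          (\<forall>u\<in>nodes G. \<forall>v\<in>nodes G. {u, v} \<in> edges G \<longleftrightarrow> {f u, f v} \<in> edges H))"

text \<open>The star \<open>K\<^bsub>1,k\<^esub>\<close> with centre \<open>0\<close>.\<close>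

definition star :: "nat \<Rightarrow> nat ugraph" where
  "star k = ({0..k}, {{0, i} |i. i \<in> {1..k}})"

definition frame :: "'a ugraph \<Rightarrow> nat \<Rightarrow> 'a ugraph \<Rightarrow> bool" where
  "frame G k H \<longleftrightarrow> subgraph_of H G \<and> isomorphic_graphs H (star k)"

definition k_system :: "'a ugraph \<Rightarrow> nat \<Rightarrow> 'a set set \<Rightarrow> bool" where
  "k_system G k \<S> \<longleftrightarrow>
     (\<forall>S\<in>\<S>. S \<noteq> {} \<and> S \<subseteq> nodes G \<and> regular k (induced G S)) \<and>
     (\<forall>H. frame G k H \<longrightarrow> (\<exists>!S. S \<in> \<S> \<and> nodes H \<subseteq> S))"

definition polytope_vertices :: "'a::euclidean_space set \<Rightarrow> 'a set" where
  "polytope_vertices P = {v. v extreme_point_of P}"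

definition polytope_graph :: "'a::euclidean_space set \<Rightarrow> 'a ugraph" where
  "polytope_graph P = (polytope_vertices P, {polytope_vertices e |e. e edge_of P})"

definition face_vertex_sets :: "nat \<Rightarrow> 'a::euclidean_space set \<Rightarrow> 'a set set" where
  "face_vertex_sets k P = {polytope_vertices F |F. F face_of P \<and> aff_dim F = int k}"

text \<open>The dimension is that of the affine hull: \<open>P\<close> need not be full-dimensional in its
  ambient space.\<close>

definition simple_polytope :: "nat \<Rightarrow> 'a::euclidean_space set \<Rightarrow> bool" where
  "simple_polytope d P \<longleftrightarrow>
     polytope P \<and> aff_dim P = int d \<and>
     (\<forall>v\<in>polytope_vertices P. card {e. e edge_of P \<and> v \<in> e} = d)"

end

theory Submission imports Defs begin

text \<open>
  Fix a linear functional that is injective on the vertices, and count the stars with \<open>k\<close> leaves all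
  of which lie below the centre. In a member of a \<open>k\<close>-system, the highest node together with its
  neighbours is such a star, and distinct members yield distinct stars; so every \<open>k\<close>-system has at
  most as many members as there are such stars. For the \<open>k\<close>-faces equality holds, because on a face
  a vertex above all its neighbours is the maximum. Conversely, let a \<open>k\<close>-system attain the bound and
  let \<open>F\<close> be a \<open>k\<close>-face. Perturb a functional exposing \<open>F\<close> so that the vertices of \<open>F\<close> lie below all
  others. The star at the top of \<open>F\<close> comes from a member with the same highest node, which therefore
  lies within \<open>F\<close>; being \<open>k\<close>-regular, it is all of the vertex set of \<open>F\<close>.
\<close>

section \<open>Stars and \<open>k\<close>-systems in graphs\<close>

definition nbrs :: "'a ugraph \<Rightarrow> 'a \<Rightarrow> 'a set" where
  "nbrs G v = {w. {v, w} \<in> edges G}"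

lemma nbrs_sym: "w \<in> nbrs G v \<longleftrightarrow> v \<in> nbrs G w"
  by (simp add: nbrs_def insert_commute)

lemma nbrs_irrefl: "simple_graph G \<Longrightarrow> v \<notin> nbrs G v"
  by (force simp: simple_graph_def nbrs_def)

lemma nbrs_nodes:
  assumes "simple_graph G" "w \<in> nbrs G v"
  shows "v \<in> nodes G" "w \<in> nodes G"
  using assms by (auto simp: simple_graph_def nbrs_def)

lemma degree_induced:
  assumes "simple_graph G" "v \<in> S"
  shows "degree (induced G S) v = card (nbrs G v \<inter> S)"
proof -
  have "{e \<in> edges (induced G S). v \<in> e} = (\<lambda>w. {v, w}) ` (nbrs G v \<inter> S)"
  proof (intro equalityI subsetI)
    fix e assume "e \<in> {e \<in> edges (induced G S). v \<in> e}"
    then have e: "e \<in> edges G" "e \<subseteq> S" "v \<in> e" by (auto simp: induced_def)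
    then have "card e = 2" using assms(1) by (auto simp: simple_graph_def)
    then obtain w where "e = {v, w}" using e(3) by (auto simp: card_2_iff insert_commute)
    then show "e \<in> (\<lambda>w. {v, w}) ` (nbrs G v \<inter> S)" using e by (auto simp: nbrs_def)
  qed (use assms in \<open>auto simp: induced_def nbrs_def\<close>)
  moreover have "inj_on (\<lambda>w. {v, w}) (nbrs G v \<inter> S)"
    by (auto simp: inj_on_def doubleton_eq_iff)
  ultimately show ?thesis unfolding degree_def by (simp add: card_image)
qed

lemma star_edge_iff:
  "{i, j} \<in> edges (star k) \<longleftrightarrow> (i = 0 \<and> j \<in> {1..k}) \<or> (j = 0 \<and> i \<in> {1..k})"
  by (auto simp: star_def doubleton_eq_iff)

text \<open>The preimage of the centre \<open>0\<close> serves as \<open>v\<close>. Only the node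
  set of a frame matters for a \<open>k\<close>-system, so the edges of \<open>H\<close> can be
  forgotten.\<close>

lemma frameE:
  assumes "frame G k H"
  obtains v A where "nodes H = insert v A" "A \<subseteq> nbrs G v" "card A = k"
proof -
  obtain f where f: "bij_betw f (nodes H) {0..k}"
    "\<And>u w. \<lbrakk>u \<in> nodes H; w \<in> nodes H\<rbrakk> \<Longrightarrow> {u, w} \<in> edges H \<longleftrightarrow> {f u, f w} \<in> edges (star k)"
    using assms by (auto simp: frame_def isomorphic_graphs_def star_def)
  have sub: "edges H \<subseteq> edges G" using assms by (auto simp: frame_def subgraph_of_def)
  obtain v where v: "v \<in> nodes H" "f v = 0"
    using f(1) by (force simp: bij_betw_def image_iff)
  have "nodes H - {v} \<subseteq> nbrs G v"
  proof
    fix w assume w: "w \<in> nodes H - {v}"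
    then have "f w \<noteq> f v" using f(1) v(1) by (auto simp: bij_betw_def inj_on_def)
    then have "f w \<in> {1..k}" using f(1) w v(2) by (auto simp: bij_betw_def)
    then have "{v, w} \<in> edges H" using f(2) v w by (simp add: star_edge_iff)
    then show "w \<in> nbrs G v" using sub by (auto simp: nbrs_def)
  qed
  moreover have "card (nodes H - {v}) = k"
    using bij_betw_same_card[OF f(1)] v(1) by simp
  ultimately show thesis using that[of v "nodes H - {v}"] v(1) by (simp add: insert_absorb)
qed

lemma frame_star:
  assumes G: "simple_graph G" and A: "A \<subseteq> nbrs G v" "card A = k" and k: "k > 0"
  shows "frame G k (insert v A, (\<lambda>w. {v, w}) ` A)" (is "frame G k ?H")
proof -
  \<comment> \<open>Positivity of \<open>k\<close> supplies a leaf, and the edge to it makes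
    \<open>v\<close> a node of \<open>G\<close>.\<close>
  have fin: "finite A" and "A \<noteq> {}" using A(2) k card_gt_0_iff by blast+
  have vA: "v \<notin> A" using nbrs_irrefl[OF G] A(1) by blast
  obtain g where g: "bij_betw g A {1..k}"
    using fin A(2) by (metis card_atLeastAtMost diff_Suc_1 finite_atLeastAtMost finite_same_card_bij)
  define f where "f = g(v := 0)"
  have f: "f v = 0" "\<And>w. w \<in> A \<Longrightarrow> f w = g w" using vA by (auto simp: f_def)
  have gA: "g w \<in> {1..k}" if "w \<in> A" for w using g that by (auto simp: bij_betw_def)
  have "bij_betw f (insert v A) (insert 0 {1..k})"
    using notIn_Un_bij_betw[of v A f "{1..k}"] g f vA bij_betw_cong[of A f g] by simp
  moreover have "insert 0 {1..k} = {0..k}" by auto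
  moreover have "{u, w} \<in> edges ?H \<longleftrightarrow> {f u, f w} \<in> edges (star k)"
    if "u \<in> insert v A" "w \<in> insert v A" for u w
  proof -
    have *: "f x = 0 \<longleftrightarrow> x = v" "f x \<in> {1..k} \<longleftrightarrow> x \<in> A" if "x \<in> insert v A" for x
      using that vA f gA by (force, fastforce)
    have "{u, w} \<in> edges ?H \<longleftrightarrow> (u = v \<and> w \<in> A) \<or> (w = v \<and> u \<in> A)"
      by (auto simp: doubleton_eq_iff)
    then show ?thesis using *[OF that(1)] *[OF that(2)] by (simp add: star_edge_iff)
  qed
  ultimately have "isomorphic_graphs ?H (star k)"
    unfolding isomorphic_graphs_def by (intro exI[of _ f]) (auto simp: star_def)
  moreover have "subgraph_of ?H G"
    unfolding subgraph_of_def simple_graph_def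
  proof (intro conjI ballI)
    show "nodes ?H \<subseteq> nodes G" using A(1) nbrs_nodes[OF G] \<open>A \<noteq> {}\<close> by auto
    show "edges ?H \<subseteq> edges G" using A(1) by (auto simp: nbrs_def)
    show "e \<subseteq> nodes ?H" "card e = 2" if "e \<in> edges ?H" for e
      using that vA by (auto simp: card_2_iff)
  qed
  ultimately show ?thesis by (simp add: frame_def)
qed

text \<open>This removes isomorphisms and subgraphs from all later arguments. For
  \<open>k = 0\<close> the empty \<open>A\<close> would let \<open>v\<close> range over elements
  that are not nodes, whence the assumption on \<open>k\<close>.\<close>

lemma k_system_iff:
  assumes G: "simple_graph G" and k: "k > 0"
  shows "k_system G k \<S> \<longleftrightarrow>
    (\<forall>S\<in>\<S>. S \<noteq> {} \<and> S \<subseteq> nodes G \<and> (\<forall>v\<in>S. card (nbrs G v \<inter> S) = k)) \<and>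
    (\<forall>v A. A \<subseteq> nbrs G v \<and> card A = k \<longrightarrow> (\<exists>!S. S \<in> \<S> \<and> insert v A \<subseteq> S))"
proof -
  have "regular k (induced G S) \<longleftrightarrow> (\<forall>v\<in>S. card (nbrs G v \<inter> S) = k)" for S
  proof -
    have "nodes (induced G S) = S" by (simp add: induced_def)
    then show ?thesis unfolding regular_def using degree_induced[OF G] by simp
  qed
  moreover have "(\<forall>H. frame G k H \<longrightarrow> (\<exists>!S. S \<in> \<S> \<and> nodes H \<subseteq> S)) \<longleftrightarrow>
    (\<forall>v A. A \<subseteq> nbrs G v \<and> card A = k \<longrightarrow> (\<exists>!S. S \<in> \<S> \<and> insert v A \<subseteq> S))" (is "?L \<longleftrightarrow> ?R")
  proof
    assume L: ?L
    show ?R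
    proof (intro allI impI)
      fix v A assume "A \<subseteq> nbrs G v \<and> card A = k"
      then show "\<exists>!S. S \<in> \<S> \<and> insert v A \<subseteq> S"
        using L frame_star[OF G _ _ k, of A v] by (metis fst_conv)
    qed
  next
    assume R: ?R
    show ?L
    proof (intro allI impI)
      fix H assume "frame G k H"
      then obtain v A where "nodes H = insert v A" "A \<subseteq> nbrs G v" "card A = k"
        by (rule frameE)
      then show "\<exists>!S. S \<in> \<S> \<and> nodes H \<subseteq> S" using R by simp
    qed
  qed
  ultimately show ?thesis unfolding k_system_def by simp
qed

text \<open>Orient every edge towards its end with the larger value of \<open>\<phi>\<close>. For
  positive \<open>k\<close>, the number of these stars is the sum of
  \<open>indegree choose k\<close> over the nodes; it does not refer to any \<open>k\<close>-system,
  so it bounds all of them at once.\<close>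

definition sink_stars :: "'a ugraph \<Rightarrow> nat \<Rightarrow> ('a \<Rightarrow> real) \<Rightarrow> ('a \<times> 'a set) set" where
  "sink_stars G k \<phi> = {(v, A). A \<subseteq> nbrs G v \<and> card A = k \<and> (\<forall>w\<in>A. \<phi> w < \<phi> v)}"

lemma finite_sink_stars:
  assumes "simple_graph G" "finite (nodes G)" "k > 0"
  shows "finite (sink_stars G k \<phi>)"
proof (rule finite_subset)
  have "A \<noteq> {}" if "card A = k" for A :: "'a set" using that assms(3) by auto
  then show "sink_stars G k \<phi> \<subseteq> nodes G \<times> Pow (nodes G)"
    using nbrs_nodes[OF assms(1)] by (fastforce simp: sink_stars_def)
qed (use assms in auto)

text \<open>Hence \<open>card\<close> of a \<open>k\<close>-system is a true count, never the
  default value 0 of an infinite set.\<close>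

lemma finite_k_system: "finite (nodes G) \<Longrightarrow> k_system G k \<S> \<Longrightarrow> finite \<S>"
  by (rule finite_subset[of _ "Pow (nodes G)"]) (auto simp: k_system_def)

text \<open>The choice function \<open>t\<close> picks the highest node of each member. A star at
  the top of two members would be contained in both, against the uniqueness of the member containing
  it; this is the injectivity.\<close>

lemma k_system_sink_starsE:
  assumes G: "simple_graph G" "finite (nodes G)" and k: "k > 0"
    and \<S>: "k_system G k \<S>" and \<phi>: "inj_on \<phi> (nodes G)"
  obtains t where "inj_on (\<lambda>S. (t S, nbrs G (t S) \<inter> S)) \<S>"
    "(\<lambda>S. (t S, nbrs G (t S) \<inter> S)) ` \<S> \<subseteq> sink_stars G k \<phi>"
    "\<And>S. S \<in> \<S> \<Longrightarrow> t S \<in> S" "\<And>S w. \<lbrakk>S \<in> \<S>; w \<in> S\<rbrakk> \<Longrightarrow> \<phi> w \<le> \<phi> (t S)"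
proof -
  have sys: "\<And>S. S \<in> \<S> \<Longrightarrow> S \<noteq> {} \<and> S \<subseteq> nodes G"
    "\<And>S v. \<lbrakk>S \<in> \<S>; v \<in> S\<rbrakk> \<Longrightarrow> card (nbrs G v \<inter> S) = k"
    "\<And>v A. \<lbrakk>A \<subseteq> nbrs G v; card A = k\<rbrakk> \<Longrightarrow> \<exists>!S. S \<in> \<S> \<and> insert v A \<subseteq> S"
    using \<S>[unfolded k_system_iff[OF G(1) k]] by simp_all
  have "\<exists>v\<in>S. \<forall>w\<in>S. \<phi> w \<le> \<phi> v" if "S \<in> \<S>" for S
  proof -
    have "finite S" "S \<noteq> {}" using sys(1)[OF that] G(2) finite_subset by auto
    then have "Max (\<phi> ` S) \<in> \<phi> ` S" by simp
    then obtain v where "v \<in> S" "\<phi> v = Max (\<phi> ` S)" by auto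
    then show ?thesis using \<open>finite S\<close> by (intro bexI[of _ v]) simp_all
  qed
  then obtain t where t: "\<And>S. S \<in> \<S> \<Longrightarrow> t S \<in> S" "\<And>S w. \<lbrakk>S \<in> \<S>; w \<in> S\<rbrakk> \<Longrightarrow> \<phi> w \<le> \<phi> (t S)"
    by metis
  let ?h = "\<lambda>S. (t S, nbrs G (t S) \<inter> S)"
  have card: "card (nbrs G (t S) \<inter> S) = k" if "S \<in> \<S>" for S
    using sys(2)[OF that t(1)[OF that]] .
  have "inj_on ?h \<S>"
  proof (rule inj_onI)
    fix S T assume ST: "S \<in> \<S>" "T \<in> \<S>" "?h S = ?h T"
    have sub: "insert (fst (?h U)) (snd (?h U)) \<subseteq> U" if "U \<in> \<S>" for U
      using t(1)[OF that] by simp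
    have "insert (fst (?h S)) (snd (?h S)) \<subseteq> T"
      unfolding ST(3) by (rule sub[OF ST(2)])
    moreover have "\<exists>!S'. S' \<in> \<S> \<and> insert (fst (?h S)) (snd (?h S)) \<subseteq> S'"
      using card[OF ST(1)] by (intro sys(3)) auto
    ultimately show "S = T" using ST(1,2) sub[OF ST(1)] by blast
  qed
  moreover have "?h ` \<S> \<subseteq> sink_stars G k \<phi>"
  proof (clarsimp simp: sink_stars_def card)
    fix S w assume w: "S \<in> \<S>" "w \<in> nbrs G (t S)" "w \<in> S"
    then have "w \<noteq> t S" "w \<in> nodes G" "t S \<in> nodes G"
      using nbrs_irrefl[OF G(1)] nbrs_nodes[OF G(1) w(2)] by auto
    \<comment> \<open>Injectivity on the nodes turns the maximality of \<open>t S\<close> into a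
      strict inequality.\<close>
    then have "\<phi> w \<noteq> \<phi> (t S)" using \<phi> by (auto simp: inj_on_def)
    then show "\<phi> w < \<phi> (t S)" using t(2)[OF w(1,3)] by simp
  qed
  ultimately show thesis using t by (rule that)
qed

lemma card_k_system_le_sink_stars:
  assumes "simple_graph G" "finite (nodes G)" "k > 0" "k_system G k \<S>" "inj_on \<phi> (nodes G)"
  shows "card \<S> \<le> card (sink_stars G k \<phi>)"
proof -
  obtain t where "inj_on (\<lambda>S. (t S, nbrs G (t S) \<inter> S)) \<S>"
    "(\<lambda>S. (t S, nbrs G (t S) \<inter> S)) ` \<S> \<subseteq> sink_stars G k \<phi>"
    by (rule k_system_sink_starsE[OF assms]) (rule that)
  then show ?thesis using finite_sink_stars[OF assms(1-3)] by (rule card_inj_on_le)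
qed

text \<open>When the bound is attained, the injection from members to stars is onto.\<close>

lemma k_system_full_sink_star:
  assumes "simple_graph G" "finite (nodes G)" "k > 0" "k_system G k \<S>" "inj_on \<phi> (nodes G)"
    and "card (sink_stars G k \<phi>) \<le> card \<S>" and "(v, A) \<in> sink_stars G k \<phi>"
  obtains S where "S \<in> \<S>" "v \<in> S" "\<And>w. w \<in> S \<Longrightarrow> \<phi> w \<le> \<phi> v"
proof -
  obtain t where t: "inj_on (\<lambda>S. (t S, nbrs G (t S) \<inter> S)) \<S>"
    "(\<lambda>S. (t S, nbrs G (t S) \<inter> S)) ` \<S> \<subseteq> sink_stars G k \<phi>"
    "\<And>S. S \<in> \<S> \<Longrightarrow> t S \<in> S" "\<And>S w. \<lbrakk>S \<in> \<S>; w \<in> S\<rbrakk> \<Longrightarrow> \<phi> w \<le> \<phi> (t S)"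
    by (rule k_system_sink_starsE[OF assms(1-5)]) (rule that)
  have "(\<lambda>S. (t S, nbrs G (t S) \<inter> S)) ` \<S> = sink_stars G k \<phi>"
    using t(1,2) assms(6) finite_sink_stars[OF assms(1-3)] by (simp add: card_image card_seteq)
  then obtain S where "S \<in> \<S>" "v = t S" using assms(7) by force
  then show thesis using t(3,4) that by blast
qed

text \<open>A star with all leaves below its centre lies in some member \<open>S\<close>, and
  \<open>k\<close>-regularity makes its leaves all the neighbours of the centre in \<open>S\<close>.
  The centre is then a local maximum on \<open>S\<close>, so by \<open>sink\<close> the highest
  node, and the star is the one assigned to \<open>S\<close>.\<close>

lemma card_sink_stars_le_k_system:
  assumes G: "simple_graph G" "finite (nodes G)" and k: "k > 0"
    and \<S>: "k_system G k \<S>" and \<phi>: "inj_on \<phi> (nodes G)"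
    and sink: "\<And>S v w. \<lbrakk>S \<in> \<S>; v \<in> S; \<forall>u \<in> nbrs G v \<inter> S. \<phi> u < \<phi> v; w \<in> S\<rbrakk> \<Longrightarrow> \<phi> w \<le> \<phi> v"
  shows "card (sink_stars G k \<phi>) \<le> card \<S>"
proof -
  have sys: "\<And>S. S \<in> \<S> \<Longrightarrow> S \<noteq> {} \<and> S \<subseteq> nodes G"
    "\<And>S v. \<lbrakk>S \<in> \<S>; v \<in> S\<rbrakk> \<Longrightarrow> card (nbrs G v \<inter> S) = k"
    "\<And>v A. \<lbrakk>A \<subseteq> nbrs G v; card A = k\<rbrakk> \<Longrightarrow> \<exists>!S. S \<in> \<S> \<and> insert v A \<subseteq> S"
    using \<S>[unfolded k_system_iff[OF G(1) k]] by simp_all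
  obtain t where t: "\<And>S. S \<in> \<S> \<Longrightarrow> t S \<in> S" "\<And>S w. \<lbrakk>S \<in> \<S>; w \<in> S\<rbrakk> \<Longrightarrow> \<phi> w \<le> \<phi> (t S)"
    by (rule k_system_sink_starsE[OF G k \<S> \<phi>]) (rule that)
  have "sink_stars G k \<phi> \<subseteq> (\<lambda>S. (t S, nbrs G (t S) \<inter> S)) ` \<S>"
  proof clarify
    fix v A assume "(v, A) \<in> sink_stars G k \<phi>"
    then have A: "A \<subseteq> nbrs G v" "card A = k" "\<forall>w\<in>A. \<phi> w < \<phi> v" by (auto simp: sink_stars_def)
    then obtain S where S: "S \<in> \<S>" "v \<in> S" "A \<subseteq> S" using sys(3)[of A v] by auto
    then have SG: "S \<subseteq> nodes G" "card (nbrs G v \<inter> S) = k" using sys(1,2) by auto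
    then have "A = nbrs G v \<inter> S"
      using A S finite_subset[OF SG(1) G(2)] by (intro card_seteq) auto
    then have "\<phi> (t S) \<le> \<phi> v" using A(3) S t(1) by (intro sink[of S]) auto
    then have "\<phi> (t S) = \<phi> v" using t(2)[OF S(1,2)] by simp
    then have "t S = v" using \<phi> SG(1) S t(1) by (meson inj_onD subsetD)
    then show "(v, A) \<in> (\<lambda>S. (t S, nbrs G (t S) \<inter> S)) ` \<S>"
      using S(1) \<open>A = nbrs G v \<inter> S\<close> by blast
  qed
  then show ?thesis using finite_k_system[OF G(2) \<S>] surj_card_le by blast
qed

text \<open>Climbing replaces a connectedness argument for \<open>T\<close>. The highest node
  \<open>u\<close> of \<open>T - S\<close> lies below \<open>v\<close>, so it is no local maximum on
  \<open>T\<close> and has a higher neighbour in \<open>T\<close>. By the choice of \<open>u\<close>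
  that neighbour is in \<open>S\<close>, but no edge joins \<open>S\<close> to
  \<open>T - S\<close>.\<close>

lemma regular_subset_eq:
  fixes \<phi> :: "'a \<Rightarrow> real"
  assumes fin: "finite T" and ST: "S \<subseteq> T" and \<phi>: "inj_on \<phi> T"
    and reg: "\<And>v. v \<in> S \<Longrightarrow> card (nbrs G v \<inter> S) = k" "\<And>v. v \<in> T \<Longrightarrow> card (nbrs G v \<inter> T) = k"
    and sink: "\<And>v w. \<lbrakk>v \<in> T; \<forall>u \<in> nbrs G v \<inter> T. \<phi> u < \<phi> v; w \<in> T\<rbrakk> \<Longrightarrow> \<phi> w \<le> \<phi> v"
    and v: "v \<in> S" "\<And>w. w \<in> T \<Longrightarrow> \<phi> w \<le> \<phi> v" and irr: "simple_graph G"
  shows "S = T"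
proof (rule ccontr)
  \<comment> \<open>A node of \<open>S\<close> has \<open>k\<close> neighbours in \<open>S\<close>
    and \<open>k\<close> in the larger set \<open>T\<close>, so they are the same.\<close>
  have closed: "nbrs G w \<inter> S = nbrs G w \<inter> T" if "w \<in> S" for w
  proof (rule card_seteq)
    have "w \<in> T" using that ST by blast
    then show "card (nbrs G w \<inter> T) \<le> card (nbrs G w \<inter> S)"
      by (simp only: reg(1)[OF that] reg(2))
  qed (use fin ST in auto)
  assume "S \<noteq> T"
  then have "Max (\<phi> ` (T - S)) \<in> \<phi> ` (T - S)"
    using ST fin by (intro Max_in) auto
  then obtain u where u: "u \<in> T" "u \<notin> S" "\<phi> u = Max (\<phi> ` (T - S))" by auto
  have umax: "\<phi> w \<le> \<phi> u" if "w \<in> T" "w \<notin> S" for w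
    unfolding u(3) using that fin by (intro Max_ge) auto
  have "v \<noteq> u" using v(1) u(2) by blast
  then have "\<phi> v \<noteq> \<phi> u" using inj_onD[OF \<phi>] u(1) v(1) ST by blast
  then have "\<not> \<phi> v \<le> \<phi> u" using v(2)[OF u(1)] by linarith
  moreover have "v \<in> T" using v(1) ST by blast
  ultimately have "\<not> (\<forall>w \<in> nbrs G u \<inter> T. \<phi> w < \<phi> u)" using sink[OF u(1)] by blast
  then obtain w where w: "w \<in> nbrs G u" "w \<in> T" "\<not> \<phi> w < \<phi> u" by blast
  have "w \<noteq> u" using w(1) nbrs_irrefl[OF irr] by blast
  then have "\<phi> w \<noteq> \<phi> u" using inj_onD[OF \<phi>] w(2) u(1) by blast
  then have "\<not> \<phi> w \<le> \<phi> u" using w(3) by linarith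
  then have "w \<in> S" using umax[OF w(2)] by blast
  moreover have "u \<in> nbrs G w" using w(1) by (rule iffD1[OF nbrs_sym])
  ultimately have "u \<in> S" using closed[of w] u(1) by blast
  then show False using u(2) by simp
qed

section \<open>Generic linear functionals\<close>

text \<open>The strict inequalities satisfied by \<open>c0\<close> persist on the open set
  \<open>U\<close> around it. The functionals to be avoided fill finitely many hyperplanes, a null
  set that cannot cover \<open>U\<close>.\<close>

lemma exists_generic_functional:
  fixes c0 :: "'a::euclidean_space"
  assumes "finite D" "0 \<notin> D"
  obtains c where "\<And>d. d \<in> D \<Longrightarrow> c \<bullet> d \<noteq> 0" "\<And>d. \<lbrakk>d \<in> D; c0 \<bullet> d > 0\<rbrakk> \<Longrightarrow> c \<bullet> d > 0"
proof -
  define U where "U = (\<Inter>d \<in> {d \<in> D. c0 \<bullet> d > 0}. {c. d \<bullet> c > 0})"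
  have "open U" unfolding U_def using assms(1) by (intro open_INT) (auto simp: open_halfspace_gt)
  moreover have "c0 \<in> U" by (auto simp: U_def inner_commute)
  ultimately have "\<not> negligible U" using open_not_negligible by blast
  moreover have "negligible (\<Union>d \<in> D. {c. d \<bullet> c = 0})"
    using assms by (intro negligible_Union) (auto intro!: negligible_hyperplane)
  ultimately obtain c where "c \<in> U" "c \<notin> (\<Union>d \<in> D. {c. d \<bullet> c = 0})"
    by (meson negligible_subset subsetI)
  then show thesis using that[of c] by (auto simp: U_def inner_commute)
qed

text \<open>Genericity is applied to the nonzero differences of points of \<open>V\<close>:
  \<open>c\<close> breaks the ties of \<open>c0\<close> and keeps its strict comparisons.\<close>

lemma exists_injective_functional:
  fixes c0 :: "'a::euclidean_space"
  assumes "finite V"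
  obtains c where "inj_on (\<lambda>x. c \<bullet> x) V"
    "\<And>u w. \<lbrakk>u \<in> V; w \<in> V; c0 \<bullet> u < c0 \<bullet> w\<rbrakk> \<Longrightarrow> c \<bullet> u < c \<bullet> w"
proof -
  define D where "D = (\<lambda>(u, w). w - u) ` (V \<times> V) - {0}"
  have "finite D" "0 \<notin> D" using assms by (auto simp: D_def)
  then obtain c where c: "\<And>d. d \<in> D \<Longrightarrow> c \<bullet> d \<noteq> 0" "\<And>d. \<lbrakk>d \<in> D; c0 \<bullet> d > 0\<rbrakk> \<Longrightarrow> c \<bullet> d > 0"
    using exists_generic_functional by blast
  have D: "w - u \<in> D" if "u \<in> V" "w \<in> V" "u \<noteq> w" for u w
    using that by (force simp: D_def)
  have "inj_on (\<lambda>x. c \<bullet> x) V"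
  proof (rule inj_onI, rule ccontr)
    fix u w assume "u \<in> V" "w \<in> V" "c \<bullet> u = c \<bullet> w" "u \<noteq> w"
    then show False using c(1)[OF D[of u w]] by (simp add: inner_diff_right)
  qed
  moreover have "c \<bullet> u < c \<bullet> w" if "u \<in> V" "w \<in> V" "c0 \<bullet> u < c0 \<bullet> w" for u w
  proof -
    have "u \<noteq> w" using that(3) by auto
    then show ?thesis using c(2)[OF D[of u w]] that by (simp add: inner_diff_right)
  qed
  ultimately show thesis by (rule that)
qed

text \<open>The values on \<open>B\<close> extend to a linear form, which the adjoint represents as
  an inner product.\<close>

lemma exists_functional_on_independent:
  fixes B :: "'a::euclidean_space set"
  assumes "independent B"
  obtains c where "\<And>x. x \<in> B \<Longrightarrow> c \<bullet> x = f x"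
proof -
  obtain g where g: "linear g" "\<forall>x\<in>B. g x = f x"
    using linear_independent_extend[OF assms] by blast
  have "adjoint g 1 \<bullet> x = g x" for x
    using adjoint_works[OF g(1), of x 1] by (simp add: inner_commute)
  then show thesis using g(2) that[of "adjoint g 1"] by simp
qed

section \<open>Edges and faces at a vertex of a polytope\<close>

lemma edge_of_polytopeE:
  fixes P :: "'a::euclidean_space set"
  assumes "polytope P" "e edge_of P"
  obtains a b where "a \<noteq> b" "e = closed_segment a b"
proof -
  have e: "e face_of P" "aff_dim e = 1"
    using assms(2) by (auto simp: edge_of_def)
  then have "polytope e"
    using assms(1) face_of_polytope_polytope by blast
  moreover have "e \<noteq> {}" "collinear e"
    using e(2) by (auto simp: collinear_aff_dim)
  ultimately obtain a b where ab: "e = closed_segment a b"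
    using compact_convex_collinear_segment polytope_imp_compact polytope_imp_convex by blast
  with e(2) have "a \<noteq> b" by auto
  with ab that show thesis by blast
qed

lemma polytope_vertices_segment [simp]: "polytope_vertices (closed_segment a b) = {a, b}"
  by (auto simp: polytope_vertices_def extreme_point_of_segment)

lemma closed_segment_edge_of:
  fixes P :: "'a::euclidean_space set"
  assumes "a \<noteq> b"
  shows "closed_segment a b edge_of P \<longleftrightarrow> closed_segment a b face_of P"
proof -
  have "aff_dim (closed_segment a b) = 1"
    using assms aff_dim_simplex one_simplex_segment by blast
  then show ?thesis by (simp add: edge_of_def)
qed

lemma nodes_polytope_graph: "nodes (polytope_graph P) = polytope_vertices P"
  by (simp add: polytope_graph_def)

lemma mem_nbrs_polytope_graph:
  fixes P :: "'a::euclidean_space set"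
  assumes "polytope P"
  shows "w \<in> nbrs (polytope_graph P) v \<longleftrightarrow> v \<noteq> w \<and> closed_segment v w face_of P"
proof
  assume "w \<in> nbrs (polytope_graph P) v"
  then obtain e where e: "e edge_of P" "{v, w} = polytope_vertices e"
    by (auto simp: nbrs_def polytope_graph_def)
  then obtain a b where ab: "a \<noteq> b" "e = closed_segment a b"
    using edge_of_polytopeE[OF assms] by metis
  then have "{v, w} = {a, b}" using e by simp
  then have "v \<noteq> w" "e = closed_segment v w"
    using ab by (auto simp: doubleton_eq_iff closed_segment_commute)
  then show "v \<noteq> w \<and> closed_segment v w face_of P"
    using e(1) by (simp add: edge_of_def)
next
  assume "v \<noteq> w \<and> closed_segment v w face_of P"
  then have "closed_segment v w edge_of P" by (simp add: closed_segment_edge_of)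
  then show "w \<in> nbrs (polytope_graph P) v"
    unfolding nbrs_def polytope_graph_def by (auto intro!: exI[of _ "closed_segment v w"])
qed

lemma simple_graph_polytope_graph:
  fixes P :: "'a::euclidean_space set"
  assumes "polytope P"
  shows "simple_graph (polytope_graph P)"
  unfolding simple_graph_def
proof
  fix x assume "x \<in> edges (polytope_graph P)"
  then obtain e where e: "e edge_of P" "x = polytope_vertices e"
    by (auto simp: polytope_graph_def)
  then obtain a b where ab: "a \<noteq> b" "e = closed_segment a b"
    using edge_of_polytopeE[OF assms] by metis
  then have "closed_segment a b face_of P" using e by (simp add: edge_of_def)
  then show "x \<subseteq> nodes (polytope_graph P) \<and> card x = 2"
    using e ab segment_face_of[of a b P] nodes_polytope_graph[of P]
    by (simp add: polytope_vertices_def[of P])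
qed

lemma finite_polytope_vertices: "polytope P \<Longrightarrow> finite (polytope_vertices P)"
  for P :: "'a::euclidean_space set"
  by (simp add: polytope_vertices_def finite_polyhedron_extreme_points polytope_imp_polyhedron)

lemma polytope_vertices_face:
  "F face_of P \<Longrightarrow> polytope_vertices F = polytope_vertices P \<inter> F"
  by (auto simp: polytope_vertices_def extreme_point_of_face)

lemma polytope_eq_hull_vertices:
  fixes P :: "'a::euclidean_space set"
  assumes "polytope P"
  shows "P = convex hull (polytope_vertices P)"
  unfolding polytope_vertices_def
  using Krein_Milman_Minkowski assms polytope_imp_compact polytope_imp_convex by blast

lemma nbrs_polytope_graph_face:
  fixes P :: "'a::euclidean_space set"
  assumes "polytope P" "F face_of P" "v \<in> F"
  shows "nbrs (polytope_graph F) v = nbrs (polytope_graph P) v \<inter> F"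
proof -
  have F: "polytope F" "convex F"
    using assms face_of_polytope_polytope polytope_imp_convex by blast+
  then show ?thesis
    using assms by (auto simp: mem_nbrs_polytope_graph face_of_face closed_segment_subset)
qed

section \<open>Local maxima of linear functionals on a polytope are global\<close>

lemma compact_convex_le_if_extreme_le:
  fixes Q :: "'a::euclidean_space set"
  assumes "compact Q" "convex Q" "\<And>q. q extreme_point_of Q \<Longrightarrow> c \<bullet> q \<le> b" "x \<in> Q"
  shows "c \<bullet> x \<le> b"
proof -
  have "convex hull {q. q extreme_point_of Q} \<subseteq> {x. c \<bullet> x \<le> b}"
    using assms(3) by (intro hull_minimal) (auto simp: convex_halfspace_le)
  then show ?thesis
    using Krein_Milman_Minkowski[OF assms(1,2)] assms(4) by blast
qed

text \<open>The smallest face containing \<open>x\<close> works: on its relative frontier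
  \<open>x\<close> would lie in a proper face of it, which is a smaller face of
  \<open>S\<close>.\<close>

lemma polyhedron_point_in_rel_interior_face:
  fixes S :: "'a::euclidean_space set"
  assumes "polyhedron S" "x \<in> S"
  obtains F where "F face_of S" "x \<in> rel_interior F"
proof -
  let ?F = "\<Inter>{F. F face_of S \<and> x \<in> F}"
  have "S face_of S" using assms(1) face_of_refl polyhedron_imp_convex by blast
  then have F: "?F face_of S" using assms(2) by (intro face_of_Inter) auto
  have poly: "polyhedron ?F" using F assms(1) face_of_polyhedron_polyhedron by blast
  have "x \<notin> rel_frontier ?F"
  proof
    assume "x \<in> rel_frontier ?F"
    then obtain F' where F': "F' face_of ?F" "F' \<noteq> ?F" "x \<in> F'"
      using rel_frontier_of_polyhedron_alt[OF poly] by auto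
    then have "F' face_of S" using F face_of_trans by blast
    then have "?F \<subseteq> F'" using F'(3) by blast
    then show False using F' face_of_imp_subset by blast
  qed
  moreover have "x \<in> ?F" by blast
  ultimately have "x \<in> rel_interior ?F"
    by (metis DiffI closure_subset in_mono rel_frontier_def)
  with F that show thesis by blast
qed

text \<open>Take the face with \<open>q\<close> in its relative interior. If its dimension were at
  least 2, the hyperplane would cut it in at least a line's worth of directions, and
  \<open>q\<close> could move both ways along one of them inside the section.\<close>

lemma extreme_point_of_hyperplane_section:
  fixes P :: "'a::euclidean_space set"
  assumes "polyhedron P" "q extreme_point_of (P \<inter> {x. a \<bullet> x = \<beta>})"
  obtains F where "F face_of P" "q \<in> F" "aff_dim F \<le> 1"
proof -
  have q: "q \<in> P" "a \<bullet> q = \<beta>" using assms(2) by (auto simp: extreme_point_of_def)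
  obtain F where F: "F face_of P" "q \<in> rel_interior F"
    using polyhedron_point_in_rel_interior_face[OF assms(1) q(1)] by blast
  have "aff_dim F \<le> 1"
  proof (rule ccontr)
    assume "\<not> aff_dim F \<le> 1"
    moreover have "q \<in> affine hull F"
      using F(2) rel_interior_subset by (blast intro: hull_inc)
    ultimately have "aff_dim (affine hull F \<inter> {x. a \<bullet> x = \<beta>}) \<ge> 1"
      using q(2) by (auto simp: aff_dim_affine_Int_hyperplane split: if_splits)
    then have "\<not> affine hull F \<inter> {x. a \<bullet> x = \<beta>} \<subseteq> {q}"
      by (metis aff_dim_subset aff_dim_sing not_one_le_zero order_trans)
    then obtain y where y: "y \<in> affine hull F" "a \<bullet> y = \<beta>" "y \<noteq> q" by blast
    obtain e where e: "e > 0" "ball q e \<inter> affine hull F \<subseteq> F"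
      using F(2) by (auto simp: mem_rel_interior_ball)
    \<comment> \<open>A displacement of length \<open>e / 2\<close> in either direction stays inside
      the ball.\<close>
    define t where "t = e / (2 * norm (y - q))"
    have n: "norm (y - q) > 0" using y(3) by simp
    have t: "t > 0" "t * norm (y - q) < e" using e(1) n by (auto simp: t_def)
    have *: "q + s *\<^sub>R (y - q) \<in> P \<inter> {x. a \<bullet> x = \<beta>}" if "\<bar>s\<bar> = t" for s
    proof -
      have "q + s *\<^sub>R (y - q) = (1 - s) *\<^sub>R q + s *\<^sub>R y" by (simp add: algebra_simps)
      moreover have "(1 - s) *\<^sub>R q + s *\<^sub>R y \<in> affine hull F"
        using mem_affine[OF affine_affine_hull \<open>q \<in> affine hull F\<close> y(1)] by simp
      moreover have "q + s *\<^sub>R (y - q) \<in> ball q e" using that t(2) by (simp add: dist_norm)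
      ultimately have "q + s *\<^sub>R (y - q) \<in> P"
        using e(2) F(1) face_of_imp_subset by fastforce
      then show ?thesis using q(2) y(2) by (simp add: inner_add_right inner_diff_right)
    qed
    have "q \<in> open_segment (q + (-t) *\<^sub>R (y - q)) (q + t *\<^sub>R (y - q))"
    proof -
      have "q = midpoint (q + (-t) *\<^sub>R (y - q)) (q + t *\<^sub>R (y - q))"
        by (simp add: midpoint_def flip: scaleR_2)
      moreover have "q + (-t) *\<^sub>R (y - q) \<noteq> q + t *\<^sub>R (y - q)"
        using t(1) y(3) by (simp del: scaleR_minus_left)
      ultimately show ?thesis by (metis midpoint_in_open_segment)
    qed
    moreover have "q + (-t) *\<^sub>R (y - q) \<in> P \<inter> {x. a \<bullet> x = \<beta>}" "q + t *\<^sub>R (y - q) \<in> P \<inter> {x. a \<bullet> x = \<beta>}"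
      using *[of t] *[of "-t"] t(1) by auto
    ultimately show False using assms(2) unfolding extreme_point_of_def by blast
  qed
  moreover have "q \<in> F" using F(2) rel_interior_subset by blast
  ultimately show thesis using F(1) that by blast
qed

text \<open>The vertices of the vertex figure at \<open>v\<close>, a section of \<open>P\<close> by a hyperplane separating \<open>v\<close> from
  the other vertices, lie on edges at \<open>v\<close>, so a functional exceeding its value at \<open>v\<close> somewhere on
  \<open>P\<close> already does so along an edge.\<close>

lemma polytope_le_if_nbrs_le:
  fixes P :: "'a::euclidean_space set"
  assumes P: "polytope P" and v: "v \<in> polytope_vertices P"
    and nb: "\<And>w. w \<in> nbrs (polytope_graph P) v \<Longrightarrow> c \<bullet> w \<le> c \<bullet> v"
    and x: "x \<in> P"
  shows "c \<bullet> x \<le> c \<bullet> v"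
proof (rule ccontr)
  assume "\<not> c \<bullet> x \<le> c \<bullet> v"
  then obtain w0 where w0: "w0 \<in> polytope_vertices P" "c \<bullet> w0 > c \<bullet> v"
    using compact_convex_le_if_extreme_le[of P c "c \<bullet> v" x] P x polytope_imp_compact polytope_imp_convex
    by (force simp: polytope_vertices_def)
  have fin: "finite (polytope_vertices P)" using P by (rule finite_polytope_vertices)
  have VP: "polytope_vertices P \<subseteq> P" by (auto simp: polytope_vertices_def extreme_point_of_def)
  \<comment> \<open>The functional \<open>a\<close> exposing \<open>v\<close> provides the
    hyperplanes that cut \<open>v\<close> off.\<close>
  have "{v} exposed_face_of P"
    using v P by (simp add: exposed_face_of_polyhedron polytope_imp_polyhedron face_of_singleton polytope_vertices_def)
  moreover have "P \<noteq> {v}" using w0 VP by auto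
  ultimately obtain a b where ab: "P \<subseteq> {x. a \<bullet> x \<le> b}" "{v} = P \<inter> {x. a \<bullet> x = b}"
    by (auto simp: exposed_face_of)
  have av: "a \<bullet> v = b" using ab(2) by blast
  have aw: "a \<bullet> w < b" if "w \<in> polytope_vertices P" "w \<noteq> v" for w
  proof -
    have "a \<bullet> w \<le> b" "a \<bullet> w \<noteq> b" using ab that VP by blast+
    then show ?thesis by simp
  qed
  define m where "m = Max ((\<lambda>w. a \<bullet> w) ` (polytope_vertices P - {v}))"
  have "w0 \<noteq> v" using w0(2) by auto
  have m: "a \<bullet> w \<le> m" if "w \<in> polytope_vertices P" "w \<noteq> v" for w
    unfolding m_def using fin that by (intro Max_ge) auto
  have "m < b" unfolding m_def
    using fin aw w0 \<open>w0 \<noteq> v\<close> by (subst Max_less_iff) auto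
  \<comment> \<open>The level \<beta> lies strictly between the value at \<open>v\<close> and those
    at all other vertices.\<close>
  then obtain \<beta> where \<beta>: "m < \<beta>" "\<beta> < b" using dense by blast
  let ?Q = "P \<inter> {x. a \<bullet> x = \<beta>}"
  have Q: "compact ?Q" "convex ?Q"
    using P by (auto intro!: compact_Int_closed convex_Int simp: polytope_imp_compact polytope_imp_convex closed_hyperplane convex_hyperplane)
  \<comment> \<open>The parameter at which the segment from \<open>v\<close> to \<open>w0\<close>
    meets the hyperplane; since \<open>t > 0\<close>, the functional \<open>c\<close> still exceeds
    its value at \<open>v\<close> there.\<close>
  define t where "t = (b - \<beta>) / (b - a \<bullet> w0)"
  have "a \<bullet> w0 < \<beta>" using m[OF w0(1) \<open>w0 \<noteq> v\<close>] \<beta> by simp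
  then have t: "0 < t" "t < 1" and teq: "t * (b - a \<bullet> w0) = b - \<beta>"
    using \<beta> by (auto simp: t_def)
  have "(1 - t) *\<^sub>R v + t *\<^sub>R w0 \<in> P"
    using P t v w0(1) VP by (intro convexD) (auto simp: polytope_imp_convex)
  moreover have "a \<bullet> ((1 - t) *\<^sub>R v + t *\<^sub>R w0) = \<beta>"
    using teq av by (simp add: inner_add_right algebra_simps)
  moreover have "c \<bullet> ((1 - t) *\<^sub>R v + t *\<^sub>R w0) > c \<bullet> v"
  proof -
    have "t * (c \<bullet> w0 - c \<bullet> v) > 0" using t w0(2) by simp
    then show ?thesis by (simp add: inner_add_right algebra_simps)
  qed
  ultimately obtain q where q: "q extreme_point_of ?Q" "c \<bullet> q > c \<bullet> v"
    using compact_convex_le_if_extreme_le[OF Q, of c "c \<bullet> v"]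
    by (metis (mono_tags, lifting) IntI mem_Collect_eq not_le)
  then have aq: "a \<bullet> q = \<beta>" by (auto simp: extreme_point_of_def)
  obtain F where F: "F face_of P" "q \<in> F" "aff_dim F \<le> 1"
    using extreme_point_of_hyperplane_section[OF polytope_imp_polyhedron[OF P] q(1)] by blast
  then have "polytope F" "F \<noteq> {}" "collinear F"
    using P face_of_polytope_polytope by (auto simp: collinear_aff_dim)
  then obtain p r where pr: "F = closed_segment p r"
    using compact_convex_collinear_segment polytope_imp_compact polytope_imp_convex by blast
  have pv: "p \<in> polytope_vertices P" "r \<in> polytope_vertices P"
    using segment_face_of F(1) unfolding pr polytope_vertices_def by blast+
  \<comment> \<open>Were neither end \<open>v\<close>, all of \<open>F\<close> would be at level at
    most \<open>m < \<beta>\<close>, yet \<open>q\<close> lies in \<open>F\<close> at level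
    \<beta>.\<close>
  have "F \<subseteq> {x. a \<bullet> x \<le> m}" if "p \<noteq> v" "r \<noteq> v"
    unfolding pr using m pv that
    by (intro closed_segment_subset) (auto simp: convex_halfspace_le)
  then have "p = v \<or> r = v" using F(2) aq \<beta> by fastforce
  then obtain w where w: "F = closed_segment v w" using pr closed_segment_commute by metis
  have "w \<noteq> v" using w F(2) aq av \<beta> by auto
  then have "w \<in> nbrs (polytope_graph P) v"
    using F(1) w P by (auto simp: mem_nbrs_polytope_graph)
  then have "F \<subseteq> {x. c \<bullet> x \<le> c \<bullet> v}"
    unfolding w using nb by (intro closed_segment_subset) (auto simp: convex_halfspace_le)
  then show False using F(2) q(2) by auto
qed

text \<open>Let \<open>z\<close> be the component of \<open>x - v\<close> orthogonal to the span. As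
  a functional \<open>z\<close> is equal at \<open>v\<close> and its neighbours, so \<open>v\<close>
  maximises it on \<open>P\<close>; evaluating at \<open>x\<close> gives
  \<open>z \<bullet> z \<le> 0\<close>.\<close>

lemma polytope_subset_span_nbrs:
  fixes P :: "'a::euclidean_space set"
  assumes P: "polytope P" and v: "v \<in> polytope_vertices P"
  shows "(\<lambda>x. x - v) ` P \<subseteq> span ((\<lambda>w. w - v) ` nbrs (polytope_graph P) v)" (is "_ \<subseteq> span ?D")
proof clarify
  fix x assume "x \<in> P"
  obtain y z where yz: "y \<in> span ?D" "\<And>u. u \<in> span ?D \<Longrightarrow> orthogonal z u" "x - v = y + z"
    by (rule orthogonal_subspace_decomp_exists[of ?D "x - v"]) (rule that)
  have zw: "z \<bullet> (w - v) = 0" if "w \<in> nbrs (polytope_graph P) v" for w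
    using yz(2)[of "w - v"] that by (auto simp: orthogonal_def intro: span_base)
  have "z \<bullet> x \<le> z \<bullet> v"
    by (rule polytope_le_if_nbrs_le[OF P v _ \<open>x \<in> P\<close>]) (use zw in \<open>simp add: inner_diff_right\<close>)
  then have "z \<bullet> (y + z) \<le> 0" unfolding yz(3)[symmetric] by (simp add: inner_diff_right)
  moreover have "z \<bullet> y = 0" using yz by (simp add: orthogonal_def)
  ultimately have "z = 0"
    using inner_ge_zero[of z] inner_eq_zero_iff[of z] by (simp add: inner_add_right)
  then show "x - v \<in> span ?D" using yz by simp
qed

lemma nbrs_subset_polytope:
  fixes P :: "'a::euclidean_space set"
  assumes "polytope P"
  shows "nbrs (polytope_graph P) v \<subseteq> polytope_vertices P"
  using assms segment_face_of by (auto simp: mem_nbrs_polytope_graph polytope_vertices_def)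

lemma polytope_vertices_subset: "polytope_vertices P \<subseteq> P"
  by (auto simp: polytope_vertices_def extreme_point_of_def)

lemma aff_dim_polytope_nbrs:
  fixes P :: "'a::euclidean_space set"
  assumes P: "polytope P" and v: "v \<in> polytope_vertices P"
  shows "aff_dim P = int (dim ((\<lambda>w. w - v) ` nbrs (polytope_graph P) v))" (is "_ = int (dim ?D)")
proof -
  have "v \<in> affine hull P" using v polytope_vertices_subset by (blast intro: hull_inc)
  then have "aff_dim P = int (dim ((\<lambda>x. x - v) ` P))" by (rule aff_dim_eq_dim_subtract)
  moreover have "?D \<subseteq> (\<lambda>x. x - v) ` P"
    using nbrs_subset_polytope[OF P] polytope_vertices_subset by fast
  then have "dim ((\<lambda>x. x - v) ` P) = dim ?D"
    using polytope_subset_span_nbrs[OF P v] dim_subset dim_span by (metis antisym)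
  ultimately show ?thesis by simp
qed

section \<open>Faces of simple polytopes\<close>

text \<open>A functional exposing \<open>F'\<close> is constant on \<open>v\<close> and its
  neighbours in \<open>F\<close>, so \<open>v\<close> minimises it on \<open>F\<close>. As
  \<open>v\<close> also maximises it on \<open>P\<close>, it is constant on \<open>F\<close>. Thus a
  face through \<open>v\<close> is determined by the neighbours of \<open>v\<close> in it.\<close>

lemma polytope_face_subset_if_nbrs_subset:
  fixes P :: "'a::euclidean_space set"
  assumes P: "polytope P" and v: "v \<in> polytope_vertices P"
    and F: "F face_of P" "v \<in> F" and F': "F' face_of P" "v \<in> F'"
    and sub: "nbrs (polytope_graph P) v \<inter> F \<subseteq> F'"
  shows "F \<subseteq> F'"
proof (cases "F' = P")
  case True
  then show ?thesis using F(1) face_of_imp_subset by blast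
next
  case False
  have "F' exposed_face_of P"
    using F'(1) P by (simp add: exposed_face_of_polyhedron polytope_imp_polyhedron)
  then obtain a b where ab: "P \<subseteq> {x. a \<bullet> x \<le> b}" "F' = P \<inter> {x. a \<bullet> x = b}"
    using False F'(2) by (auto simp: exposed_face_of)
  have FP: "F \<subseteq> P" using F(1) face_of_imp_subset by blast
  have "v \<in> polytope_vertices F" using F v polytope_vertices_face by blast
  moreover have "polytope F" using F(1) P face_of_polytope_polytope by blast
  moreover have "(- a) \<bullet> w \<le> (- a) \<bullet> v" if "w \<in> nbrs (polytope_graph F) v" for w
  proof -
    have "w \<in> F'" using that sub nbrs_polytope_graph_face[OF P F] by auto
    then show ?thesis using ab(2) F'(2) by auto
  qed
  ultimately have "(- a) \<bullet> x \<le> (- a) \<bullet> v" if "x \<in> F" for x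
    using polytope_le_if_nbrs_le that by blast
  then show ?thesis using ab F'(2) FP by force
qed

text \<open>Simplicity counts edges as point sets; sending \<open>w\<close> to the segment from
  \<open>v\<close> to \<open>w\<close> matches them with neighbours.\<close>

lemma card_nbrs_simple_polytope:
  fixes P :: "'a::euclidean_space set"
  assumes P: "simple_polytope d P" and v: "v \<in> polytope_vertices P"
  shows "card (nbrs (polytope_graph P) v) = d"
proof -
  have poly: "polytope P" using P by (simp add: simple_polytope_def)
  have "{e. e edge_of P \<and> v \<in> e} = closed_segment v ` nbrs (polytope_graph P) v"
  proof (intro equalityI subsetI)
    fix e assume "e \<in> {e. e edge_of P \<and> v \<in> e}"
    then have e: "e edge_of P" "v \<in> e" by auto
    then have face: "e face_of P" by (simp add: edge_of_def)
    obtain a b where ab: "a \<noteq> b" "e = closed_segment a b"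
      using edge_of_polytopeE[OF poly e(1)] by metis
    have "v \<in> polytope_vertices e" using face v e(2) polytope_vertices_face by blast
    then have "v = a \<or> v = b" using ab by simp
    then obtain w where "v \<noteq> w" "e = closed_segment v w"
      using ab closed_segment_commute by metis
    then show "e \<in> closed_segment v ` nbrs (polytope_graph P) v"
      using face by (auto simp: mem_nbrs_polytope_graph[OF poly])
  qed (auto simp: mem_nbrs_polytope_graph[OF poly] closed_segment_edge_of)
  moreover have "inj_on (closed_segment v) (nbrs (polytope_graph P) v)"
  proof (rule inj_onI)
    fix w w' assume "closed_segment v w = closed_segment v w'"
    then have "{v, w} = {v, w'}" by (metis polytope_vertices_segment)
    then show "w = w'" by (auto simp: doubleton_eq_iff)
  qed
  ultimately have "card (nbrs (polytope_graph P) v) = card {e. e edge_of P \<and> v \<in> e}"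
    by (simp only: card_image)
  then show ?thesis using P v by (simp add: simple_polytope_def)
qed

text \<open>These \<open>d\<close> vectors span a space of dimension \<open>d\<close>.\<close>

lemma independent_nbrs_simple_polytope:
  fixes P :: "'a::euclidean_space set"
  assumes P: "simple_polytope d P" and v: "v \<in> polytope_vertices P"
  shows "independent ((\<lambda>w. w - v) ` nbrs (polytope_graph P) v)" (is "independent ?D")
proof -
  have poly: "polytope P" using P by (simp add: simple_polytope_def)
  have "finite ?D"
    using nbrs_subset_polytope[OF poly] finite_polytope_vertices[OF poly] by (auto intro: finite_subset)
  moreover have "dim ?D = d"
    using aff_dim_polytope_nbrs[OF poly v] P by (simp add: simple_polytope_def)
  moreover have "card ?D = d"
    using card_nbrs_simple_polytope[OF P v] by (simp add: card_image)
  ultimately show ?thesis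
    by (intro card_le_dim_spanning[of ?D ?D]) (auto intro: span_base)
qed

text \<open>The directions to the neighbours in \<open>F\<close> span those of \<open>F\<close>, and
  they inherit independence from \<open>P\<close>.\<close>

lemma aff_dim_face_eq_card_nbrs:
  fixes P :: "'a::euclidean_space set"
  assumes P: "simple_polytope d P" and v: "v \<in> polytope_vertices P"
    and F: "F face_of P" "v \<in> F"
  shows "aff_dim F = int (card (nbrs (polytope_graph P) v \<inter> F))"
proof -
  have poly: "polytope P" using P by (simp add: simple_polytope_def)
  let ?A = "nbrs (polytope_graph P) v \<inter> F"
  have "polytope F" "v \<in> polytope_vertices F"
    using F v poly face_of_polytope_polytope polytope_vertices_face by blast+
  then have "aff_dim F = int (dim ((\<lambda>w. w - v) ` ?A))"
    using aff_dim_polytope_nbrs nbrs_polytope_graph_face[OF poly F] by metis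
  moreover have "independent ((\<lambda>w. w - v) ` ?A)"
    using independent_nbrs_simple_polytope[OF P v] by (rule independent_mono) auto
  ultimately show ?thesis by (simp add: dim_eq_card_independent card_image)
qed

text \<open>By independence some functional is level along the edges towards \<open>A\<close> and
  drops along the other edges at \<open>v\<close>. Then \<open>v\<close> maximises it on
  \<open>P\<close>, and its supporting hyperplane cuts out the face.\<close>

lemma face_through_nbrs:
  fixes P :: "'a::euclidean_space set"
  assumes P: "simple_polytope d P" and v: "v \<in> polytope_vertices P"
    and A: "A \<subseteq> nbrs (polytope_graph P) v"
  obtains F where "F face_of P" "v \<in> F" "nbrs (polytope_graph P) v \<inter> F = A"
proof -
  have poly: "polytope P" using P by (simp add: simple_polytope_def)
  obtain c where c: "\<And>x. x \<in> (\<lambda>w. w - v) ` nbrs (polytope_graph P) v \<Longrightarrow>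
      c \<bullet> x = (if x + v \<in> A then 0 else -1)"
    by (rule exists_functional_on_independent[OF independent_nbrs_simple_polytope[OF P v],
          where f = "\<lambda>x. if x + v \<in> A then 0 else -1"]) (rule that)
  have cw: "c \<bullet> w = (if w \<in> A then c \<bullet> v else c \<bullet> v - 1)" if "w \<in> nbrs (polytope_graph P) v" for w
    using c[of "w - v"] that by (auto simp: inner_diff_right split: if_splits)
  have NP: "nbrs (polytope_graph P) v \<subseteq> P"
    using nbrs_subset_polytope[OF poly] polytope_vertices_subset by blast
  have le: "c \<bullet> x \<le> c \<bullet> v" if "x \<in> P" for x
    using polytope_le_if_nbrs_le[OF poly v _ that, of c] cw by (simp split: if_splits)
  show thesis
  proof
    show "P \<inter> {x. c \<bullet> x = c \<bullet> v} face_of P"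
      using le poly by (intro face_of_Int_supporting_hyperplane_le) (auto simp: polytope_imp_convex)
    show "v \<in> P \<inter> {x. c \<bullet> x = c \<bullet> v}" using v polytope_vertices_subset by blast
    show "nbrs (polytope_graph P) v \<inter> (P \<inter> {x. c \<bullet> x = c \<bullet> v}) = A"
      using cw NP A by (force split: if_splits)
  qed
qed

text \<open>Regularity is the dimension formula at each vertex. The face containing a star exists by
  \<open>face_through_nbrs\<close>; any other such \<open>k\<close>-face has the same
  \<open>k\<close> neighbours of \<open>v\<close>, hence coincides with it.\<close>

lemma k_system_face_vertex_sets:
  fixes P :: "'a::euclidean_space set"
  assumes P: "simple_polytope d P" and k: "k > 0"
  shows "k_system (polytope_graph P) k (face_vertex_sets k P)"
proof -
  let ?G = "polytope_graph P"
  have poly: "polytope P" using P by (simp add: simple_polytope_def)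
  note G = simple_graph_polytope_graph[OF poly]
  have "S \<noteq> {} \<and> S \<subseteq> nodes ?G \<and> (\<forall>v\<in>S. card (nbrs ?G v \<inter> S) = k)"
    if "S \<in> face_vertex_sets k P" for S
  proof -
    obtain F where F: "S = polytope_vertices F" "F face_of P" "aff_dim F = int k"
      using \<open>S \<in> face_vertex_sets k P\<close> by (auto simp: face_vertex_sets_def)
    have SP: "S = polytope_vertices P \<inter> F" using F polytope_vertices_face by blast
    have "polytope F" using F(2) poly face_of_polytope_polytope by blast
    \<comment> \<open>Without vertices \<open>F\<close> would be empty, of dimension -1.\<close>
    then have "S \<noteq> {}" using F(1,3) polytope_eq_hull_vertices[of F] by auto
    moreover have "card (nbrs ?G v \<inter> S) = k" if "v \<in> S" for v
    proof -
      have "nbrs ?G v \<inter> S = nbrs ?G v \<inter> F" using SP nbrs_subset_polytope[OF poly] by blast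
      then show ?thesis using aff_dim_face_eq_card_nbrs[OF P _ F(2), of v] SP that F(3) by simp
    qed
    ultimately show ?thesis using SP by (auto simp: nodes_polytope_graph)
  qed
  moreover have "\<exists>!S. S \<in> face_vertex_sets k P \<and> insert v A \<subseteq> S"
    if A: "A \<subseteq> nbrs ?G v" "card A = k" for v A
  proof -
    have AP: "A \<subseteq> polytope_vertices P" using A(1) nbrs_subset_polytope[OF poly] by blast
    have "A \<noteq> {}" using A(2) k by auto
    then have v: "v \<in> polytope_vertices P"
      using A(1) nbrs_nodes[OF G] nodes_polytope_graph[of P] by blast
    obtain F where F: "F face_of P" "v \<in> F" "nbrs ?G v \<inter> F = A"
      using face_through_nbrs[OF P v A(1)] by blast
    have dimF: "aff_dim F = int k" using aff_dim_face_eq_card_nbrs[OF P v F(1,2)] F(3) A(2) by simp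
    show ?thesis
    proof (rule ex1I)
      show "polytope_vertices F \<in> face_vertex_sets k P \<and> insert v A \<subseteq> polytope_vertices F"
        using F dimF v AP polytope_vertices_face[OF F(1)] by (auto simp: face_vertex_sets_def)
      fix S assume S: "S \<in> face_vertex_sets k P \<and> insert v A \<subseteq> S"
      then obtain F' where F': "S = polytope_vertices F'" "F' face_of P" "aff_dim F' = int k"
        by (auto simp: face_vertex_sets_def)
      then have sub: "insert v A \<subseteq> F'" using S polytope_vertices_subset by blast
      have "finite (nbrs ?G v)"
        using nbrs_subset_polytope[OF poly] finite_polytope_vertices[OF poly] by (rule finite_subset)
      then have "A = nbrs ?G v \<inter> F'"
        using aff_dim_face_eq_card_nbrs[OF P v F'(2)] F'(3) sub A by (intro card_seteq) auto
      then have "F = F'"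
        using F F'(2) sub polytope_face_subset_if_nbrs_subset[OF poly v]
        by (intro equalityI) auto
      then show "S = polytope_vertices F" using F' by simp
    qed
  qed
  ultimately show ?thesis unfolding k_system_iff[OF G k] by blast
qed

text \<open>Provides the hypothesis \<open>sink\<close> of the graph lemmas, by applying
  \<open>polytope_le_if_nbrs_le\<close> inside the face.\<close>

lemma face_vertex_set_local_max:
  fixes P :: "'a::euclidean_space set"
  assumes P: "polytope P" and S: "S \<in> face_vertex_sets k P"
    and v: "v \<in> S" "\<forall>u \<in> nbrs (polytope_graph P) v \<inter> S. c \<bullet> u < c \<bullet> v" and w: "w \<in> S"
  shows "c \<bullet> w \<le> c \<bullet> v"
proof -
  obtain F where F: "S = polytope_vertices F" "F face_of P"
    using S by (auto simp: face_vertex_sets_def)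
  have "polytope F" using F(2) P face_of_polytope_polytope by blast
  moreover have "v \<in> F" "w \<in> F" using v(1) w F(1) polytope_vertices_subset by blast+
  moreover have "c \<bullet> u \<le> c \<bullet> v" if u: "u \<in> nbrs (polytope_graph F) v" for u
  proof -
    have "u \<in> S" using nbrs_subset_polytope[OF \<open>polytope F\<close>] u F(1) by blast
    moreover have "u \<in> nbrs (polytope_graph P) v"
      using u nbrs_polytope_graph_face[OF P F(2) \<open>v \<in> F\<close>] by blast
    ultimately show ?thesis using v(2) by (blast intro: less_imp_le)
  qed
  ultimately show ?thesis using polytope_le_if_nbrs_le v(1) F(1) by blast
qed

section \<open>Maximal \<open>k\<close>-systems\<close>

theorem corollary2:
  fixes P :: "'a::euclidean_space set" and d k :: nat and \<S> :: "'a set set"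
  assumes "simple_polytope d P"
    and "2 \<le> k" and "k \<le> d - 1"
    and "k_system (polytope_graph P) k \<S>"
  shows "\<S> = face_vertex_sets k P \<longleftrightarrow>
    (\<forall>\<T>. k_system (polytope_graph P) k \<T> \<longrightarrow> card \<T> \<le> card \<S>)"
proof -
  let ?G = "polytope_graph P" and ?\<F> = "face_vertex_sets k P"
  have k: "k > 0" using assms(2) by simp
  have poly: "polytope P" using assms(1) by (simp add: simple_polytope_def)
  note G = simple_graph_polytope_graph[OF poly]
  have V: "finite (nodes ?G)"
    using finite_polytope_vertices[OF poly] by (simp add: nodes_polytope_graph)
  note \<F> = k_system_face_vertex_sets[OF assms(1) k]
  \<comment> \<open>The star count is thus the same for every generic \<open>c\<close>, so a
    functional adapted to a single face may be used below.\<close>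
  have card\<F>: "card (sink_stars ?G k (\<lambda>x. c \<bullet> x)) = card ?\<F>" if "inj_on (\<lambda>x. c \<bullet> x) (nodes ?G)" for c
    using card_k_system_le_sink_stars[OF G V k \<F> that]
      card_sink_stars_le_k_system[OF G V k \<F> that face_vertex_set_local_max[OF poly]]
    by (rule antisym[rotated])
  have upper: "card \<T> \<le> card ?\<F>" if \<T>: "k_system ?G k \<T>" for \<T>
  proof -
    obtain c where "inj_on (\<lambda>x. c \<bullet> x) (nodes ?G)"
      using exists_injective_functional[OF V] by blast
    then show ?thesis using card_k_system_le_sink_stars[OF G V k \<T>] card\<F> by metis
  qed
  have "?\<F> \<subseteq> \<S>" if le: "card ?\<F> \<le> card \<S>"
  proof
    fix T assume T: "T \<in> ?\<F>"
    then obtain F where F: "T = polytope_vertices F" "F face_of P" "aff_dim F = int k"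
      by (auto simp: face_vertex_sets_def)
    have TV: "T = nodes ?G \<inter> F"
      using F polytope_vertices_face by (auto simp: nodes_polytope_graph)
    \<comment> \<open>From \<open>2 \<le> k \<le> d - 1\<close> follows \<open>k < d\<close>, so the
      face is proper and has a nontrivial exposing functional.\<close>
    have "F \<noteq> P" "F \<noteq> {}" using F(3) assms(1-3) by (auto simp: simple_polytope_def)
    moreover have "F exposed_face_of P"
      using F(2) poly by (simp add: exposed_face_of_polyhedron polytope_imp_polyhedron)
    ultimately obtain a b where ab: "P \<subseteq> {x. a \<bullet> x \<le> b}" "F = P \<inter> {x. a \<bullet> x = b}"
      by (auto simp: exposed_face_of)
    \<comment> \<open>As \<open>a\<close> is largest on \<open>F\<close>, its negative is smallest
      there; the perturbation \<open>c\<close> keeps the vertices of \<open>F\<close> below all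
      others.\<close>
    obtain c where c: "inj_on (\<lambda>x. c \<bullet> x) (nodes ?G)"
      "\<And>u w. \<lbrakk>u \<in> nodes ?G; w \<in> nodes ?G; (- a) \<bullet> u < (- a) \<bullet> w\<rbrakk> \<Longrightarrow> c \<bullet> u < c \<bullet> w"
      using exists_injective_functional[OF V, of "- a"] by blast
    have initial: "c \<bullet> u < c \<bullet> w" if "u \<in> T" "w \<in> nodes ?G" "w \<notin> T" for u w
    proof -
      have "w \<in> P" using that(2) polytope_vertices_subset by (auto simp: nodes_polytope_graph)
      moreover have "w \<notin> F" using that TV by blast
      ultimately have "a \<bullet> w < b" using ab by force
      moreover have "a \<bullet> u = b" "u \<in> nodes ?G" using that(1) TV ab(2) by auto
      ultimately show ?thesis using c(2) that(2) by simp
    qed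
    \<comment> \<open>The top of \<open>T\<close> comes from viewing the \<open>k\<close>-faces
      themselves as a \<open>k\<close>-system.\<close>
    obtain v where v: "v \<in> T" "(v, nbrs ?G v \<inter> T) \<in> sink_stars ?G k (\<lambda>x. c \<bullet> x)"
      "\<And>w. w \<in> T \<Longrightarrow> c \<bullet> w \<le> c \<bullet> v"
      by (rule k_system_sink_starsE[OF G V k \<F> c(1)]) (use T in blast)
    obtain S where S: "S \<in> \<S>" "v \<in> S" "\<And>w. w \<in> S \<Longrightarrow> c \<bullet> w \<le> c \<bullet> v"
      using k_system_full_sink_star[OF G V k assms(4) c(1) _ v(2)] le card\<F>[OF c(1)] by metis
    have regS: "S \<subseteq> nodes ?G" "\<And>v. v \<in> S \<Longrightarrow> card (nbrs ?G v \<inter> S) = k"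
      using assms(4) S(1) by (auto simp: k_system_iff[OF G k])
    have regT: "\<And>v. v \<in> T \<Longrightarrow> card (nbrs ?G v \<inter> T) = k"
      using \<F> T by (auto simp: k_system_iff[OF G k])
    \<comment> \<open>Nodes outside \<open>T\<close> lie above \<open>v\<close>, while those of
      \<open>S\<close> do not.\<close>
    have "S \<subseteq> T" using S(3) initial[OF v(1)] regS(1) by (meson leD subset_iff)
    then have "S = T"
    proof (rule regular_subset_eq[rotated])
      show "finite T" using V TV by simp
      show "inj_on (\<lambda>x. c \<bullet> x) T" using c(1) TV by (simp add: inj_on_subset)
    qed (use regS regT face_vertex_set_local_max[OF poly T] S(2) v(3) G in auto)
    then show "T \<in> \<S>" using S(1) by simp
  qed
  \<comment> \<open>Maximality compared with the \<open>k\<close>-faces gives the inclusion; by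
    \<open>upper\<close> the finite \<S> is no larger, so the two agree.\<close>
  then show ?thesis
    using upper \<F> card_seteq[OF finite_k_system[OF V assms(4)], of ?\<F>] assms(4) by metis
qed

end
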